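(* $H^2(\widetilde{M_0},\widetilde{M_0})=0$ and $H^2(\widetilde{M_2},\widetilde{M_2})\neq 0$.
   Context: All Lie algebras are over $\mathbb{C}$, and every element is a finite linear combination of basis elements. $\widetilde{M_0}$ is the Lie algebra with basis $\{x,y,e_1,e_2,\dots\}$ and brackets $[e_i,e_1]=e_{i+1}$ ($i\ge2$), $[x,e_1]=-e_1$, $[x,e_i]=-(i-1)e_i$ ($i\ge 2$), $[y,e_i]=-e_i$ ($i\ge2$). $\widetilde{M_2}$ is the Lie algebra with basis $\{x,e_1,e_2,\dots\}$ and brackets $[e_1,e_i]=e_{i+1}$ ($i\ge2$), $[e_2,e_j]=e_{j+2}$ ($j\ge3$), $[x,e_1]=-e_1$, $[x,e_i]=-ie_i$ ($i\ge2$). In both cases brackets of basis elements not determined by these and by antisymmetry are zero. For a Lie algebra $L$, $H^2(L,L)=Z^2(L,L)/B^2(L,L)$, where $Z^2(L,L)$ is the set of all $\varphi\in\mathrm{Hom}(\wedge^2L,L)$ with $$[a,\varphi(b,c)]-[\varphi(a,b),c]+[\varphi(a,c),b]+\varphi(a,[b,c])-\varphi([a,b],c)+\varphi([a,c],b)=0\quad\text{for all }a,b,c\in L,$$ and $B^2(L,L)$ is the set of all $\psi\in\mathrm{Hom}(\wedge^2L,L)$ of the form $\psi(a,b)=[d(a),b]+[a,d(b)]-d([a,b])$ for some linear map $d\in\mathrm{Hom}(L,L)$. *)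

theory Defs
  imports Complex_Main "HOL-Library.Poly_Mapping" "HOL-Library.Set_Algebras"
    "HOL-Library.Function_Algebras"
begin

section \<open>Complex Lie algebras and their second adjoint cohomology\<close>

locale lie_algebra = vector_space scale
  for scale :: "complex \<Rightarrow> 'a::ab_group_add \<Rightarrow> 'a" +
  fixes bracket :: "'a \<Rightarrow> 'a \<Rightarrow> 'a"
  assumes linear_bracket_right: "Vector_Spaces.linear scale scale (\<lambda>b. bracket a b)"
    and linear_bracket_left: "Vector_Spaces.linear scale scale (\<lambda>a. bracket a b)"
    and bracket_self: "bracket a a = 0"
    and jacobi: "bracket a (bracket b c) + bracket b (bracket c a) + bracket c (bracket a b) = 0"
begin

text \<open>Linear maps from the exterior square are represented by alternating bilinear maps.\<close>

definition C2 :: "('a \<Rightarrow> 'a \<Rightarrow> 'a) set" where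
  "C2 = {\<phi>. (\<forall>a. Vector_Spaces.linear scale scale (\<lambda>b. \<phi> a b)) \<and> (\<forall>b. Vector_Spaces.linear scale scale (\<lambda>a. \<phi> a b)) \<and>
             (\<forall>a. \<phi> a a = 0)}"

definition Z2 :: "('a \<Rightarrow> 'a \<Rightarrow> 'a) set" where
  "Z2 = {\<phi> \<in> C2. \<forall>a b c.
     bracket a (\<phi> b c) - bracket (\<phi> a b) c + bracket (\<phi> a c) b
       + \<phi> a (bracket b c) - \<phi> (bracket a b) c + \<phi> (bracket a c) b = 0}"

definition B2 :: "('a \<Rightarrow> 'a \<Rightarrow> 'a) set" where
  "B2 = {\<psi> \<in> C2. \<exists>d. Vector_Spaces.linear scale scale d \<and>
     (\<forall>a b. \<psi> a b = bracket (d a) b + bracket a (d b) - d (bracket a b))}"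

text \<open>The quotient \<open>Z2 / B2\<close> as a set of cosets (with pointwise addition of maps);
  its zero element is the coset \<open>B2\<close>, so it vanishes iff it is \<open>{B2}\<close>.\<close>

definition H2 :: "('a \<Rightarrow> 'a \<Rightarrow> 'a) set set" where
  "H2 = (\<lambda>\<phi>. \<phi> +o B2) ` Z2"

lemma bracket_linear_simps:
  "bracket (a + b) c = bracket a c + bracket b c"
  "bracket c (a + b) = bracket c a + bracket c b"
  "bracket (a - b) c = bracket a c - bracket b c"
  "bracket c (a - b) = bracket c a - bracket c b"
  "bracket (- a) c = - bracket a c"
  "bracket c (- a) = - bracket c a"
  "bracket (scale r a) c = scale r (bracket a c)"
  "bracket c (scale r a) = scale r (bracket c a)"
  "bracket 0 c = 0" "bracket c 0 = 0"
proof -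
  interpret l: Vector_Spaces.linear scale scale "\<lambda>a. bracket a c" by (rule linear_bracket_left)
  interpret r: Vector_Spaces.linear scale scale "\<lambda>a. bracket c a" by (rule linear_bracket_right)
  show "bracket (a + b) c = bracket a c + bracket b c"
    "bracket c (a + b) = bracket c a + bracket c b"
    "bracket (a - b) c = bracket a c - bracket b c"
    "bracket c (a - b) = bracket c a - bracket c b"
    "bracket (- a) c = - bracket a c"
    "bracket c (- a) = - bracket c a"
    "bracket (scale r a) c = scale r (bracket a c)"
    "bracket c (scale r a) = scale r (bracket c a)"
    "bracket 0 c = 0" "bracket c 0 = 0"
    using l.add r.add l.diff r.diff l.neg r.neg l.scale r.scale l.zero r.zero by blast+
qed

lemma bracket_anticomm: "bracket a b = - bracket b a"
proof -
  have "bracket (a + b) (a + b) = 0" by (rule bracket_self)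
  then have "bracket a b + bracket b a = 0"
    unfolding bracket_linear_simps(1,2) by (simp add: bracket_self add.commute)
  then show ?thesis by (simp add: eq_neg_iff_add_eq_0)
qed

lemma zero_in_B2: "0 \<in> B2"
proof -
  have "Vector_Spaces.linear scale scale (\<lambda>_. 0)"
    by unfold_locales auto
  then show ?thesis
    unfolding B2_def C2_def zero_fun_def by (auto simp: bracket_linear_simps intro!: exI[of _ "\<lambda>_. 0"])
qed

lemma B2_subset_Z2: "B2 \<subseteq> Z2"
proof
  fix \<psi> assume "\<psi> \<in> B2"
  then obtain d where C: "\<psi> \<in> C2" and d: "Vector_Spaces.linear scale scale d"
    and e: "\<And>a b. \<psi> a b = bracket (d a) b + bracket a (d b) - d (bracket a b)"
    unfolding B2_def by auto
  interpret d: Vector_Spaces.linear scale scale d by (rule d)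
  have J: "bracket a (bracket b c) = bracket (bracket a b) c - bracket (bracket a c) b" for a b c
    using jacobi[of a b c] bracket_anticomm[of b "bracket a c"] bracket_anticomm[of c a]
      bracket_anticomm[of c "bracket a b"]
    by (simp add: bracket_linear_simps eq_neg_iff_add_eq_0 algebra_simps)
  have "bracket a (\<psi> b c) - bracket (\<psi> a b) c + bracket (\<psi> a c) b
       + \<psi> a (bracket b c) - \<psi> (bracket a b) c + \<psi> (bracket a c) b = 0" for a b c
    by (simp add: e J bracket_linear_simps d.diff)
  with C show "\<psi> \<in> Z2" unfolding Z2_def by blast
qed

end


section \<open>Lie algebras given by structure constants\<close>

text \<open>The vector space with basis \<open>'b\<close> is \<open>'b \<Rightarrow>\<^sub>0 complex\<close>, with basis vectors \<open>Poly_Mapping.single b 1\<close>.\<close>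

definition pscale :: "complex \<Rightarrow> ('b \<Rightarrow>\<^sub>0 complex) \<Rightarrow> ('b \<Rightarrow>\<^sub>0 complex)" where
  "pscale c = Poly_Mapping.map ((*) c)"

text \<open>\<open>T\<close> is a multiplication table listing \<open>[a, b]\<close> in at most one of the two possible
  orders of each pair of basis elements and giving 0 elsewhere; it is first antisymmetrised and
  then extended bilinearly.\<close>

definition table_bracket ::
  "('b \<Rightarrow> 'b \<Rightarrow> ('b \<Rightarrow>\<^sub>0 complex)) \<Rightarrow> ('b \<Rightarrow>\<^sub>0 complex) \<Rightarrow> ('b \<Rightarrow>\<^sub>0 complex) \<Rightarrow> ('b \<Rightarrow>\<^sub>0 complex)" where
  "table_bracket T f g =
     (\<Sum>a\<in>Poly_Mapping.keys f. \<Sum>b\<in>Poly_Mapping.keys g.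
        pscale (Poly_Mapping.lookup f a * Poly_Mapping.lookup g b) (T a b - T b a))"

lemma lookup_pscale [simp]: "Poly_Mapping.lookup (pscale c f) k = c * Poly_Mapping.lookup f k"
  by (simp add: pscale_def Poly_Mapping.map.rep_eq when_def)

lemma pscale_single [simp]: "pscale c (Poly_Mapping.single b r) = Poly_Mapping.single b (c * r)"
  by (rule poly_mapping_eqI) (simp add: lookup_single when_def)

lemma vector_space_pscale: "vector_space (pscale :: complex \<Rightarrow> ('b \<Rightarrow>\<^sub>0 complex) \<Rightarrow> _)"
  by unfold_locales (auto intro!: poly_mapping_eqI simp: lookup_add algebra_simps)

interpretation pscale: vector_space "pscale :: complex \<Rightarrow> ('b \<Rightarrow>\<^sub>0 complex) \<Rightarrow> _"
  by (rule vector_space_pscale)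

interpretation pscale_pair: vector_space_pair
  "pscale :: complex \<Rightarrow> ('b \<Rightarrow>\<^sub>0 complex) \<Rightarrow> _" "pscale :: complex \<Rightarrow> ('c \<Rightarrow>\<^sub>0 complex) \<Rightarrow> _"
  by (intro vector_space_pair.intro vector_space_pscale)

lemma table_bracket_superset:
  assumes "finite A" "finite B" "Poly_Mapping.keys f \<subseteq> A" "Poly_Mapping.keys g \<subseteq> B"
  shows "table_bracket T f g =
     (\<Sum>a\<in>A. \<Sum>b\<in>B. pscale (Poly_Mapping.lookup f a * Poly_Mapping.lookup g b) (T a b - T b a))"
proof -
  have "table_bracket T f g = (\<Sum>a\<in>Poly_Mapping.keys f. \<Sum>b\<in>B.
      pscale (Poly_Mapping.lookup f a * Poly_Mapping.lookup g b) (T a b - T b a))"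
    unfolding table_bracket_def using assms
    by (intro sum.cong sum.mono_neutral_left refl) (auto simp: in_keys_iff)
  also have "\<dots> = (\<Sum>a\<in>A. \<Sum>b\<in>B.
      pscale (Poly_Mapping.lookup f a * Poly_Mapping.lookup g b) (T a b - T b a))"
    using assms by (intro sum.mono_neutral_left) (auto simp: in_keys_iff)
  finally show ?thesis .
qed

lemma table_bracket_anticomm: "table_bracket T f g = - table_bracket T g f"
proof -
  have "pscale (Poly_Mapping.lookup f a * Poly_Mapping.lookup g b) (T a b - T b a)
      = - pscale (Poly_Mapping.lookup g b * Poly_Mapping.lookup f a) (T b a - T a b)" for a b
    by (rule poly_mapping_eqI) (simp add: lookup_minus algebra_simps)
  then have "table_bracket T f g = (\<Sum>a\<in>Poly_Mapping.keys f. \<Sum>b\<in>Poly_Mapping.keys g.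
      - pscale (Poly_Mapping.lookup g b * Poly_Mapping.lookup f a) (T b a - T a b))"
    unfolding table_bracket_def by simp
  also have "\<dots> = - table_bracket T g f"
    unfolding table_bracket_def sum_negf by (subst sum.swap) simp
  finally show ?thesis .
qed

lemma linear_table_bracket_right: "Vector_Spaces.linear pscale pscale (\<lambda>g. table_bracket T f g)"
proof (unfold Vector_Spaces.linear_iff, intro conjI allI vector_space_pscale)
  fix g h :: "'a \<Rightarrow>\<^sub>0 complex"
  let ?B = "Poly_Mapping.keys g \<union> Poly_Mapping.keys h"
  have *: "Poly_Mapping.keys (g + h) \<subseteq> ?B" by (rule keys_add)
  show "table_bracket T f (g + h) = table_bracket T f g + table_bracket T f h"
    by (simp add: * table_bracket_superset[of "Poly_Mapping.keys f" ?B] lookup_add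
        distrib_left pscale.scale_left_distrib sum.distrib del: keys_add)
next
  fix c :: complex and g :: "'a \<Rightarrow>\<^sub>0 complex"
  have *: "Poly_Mapping.keys (pscale c g) \<subseteq> Poly_Mapping.keys g" by (auto simp: in_keys_iff)
  show "table_bracket T f (pscale c g) = pscale c (table_bracket T f g)"
    by (simp add: * table_bracket_superset[of "Poly_Mapping.keys f" "Poly_Mapping.keys g"]
        pscale.scale_sum_right mult.left_commute)
qed

lemma linear_table_bracket_left: "Vector_Spaces.linear pscale pscale (\<lambda>f. table_bracket T f g)"
proof -
  have "Vector_Spaces.linear pscale pscale (\<lambda>f. - table_bracket T g f)"
    using linear_table_bracket_right[of T g] by (rule pscale_pair.linear_compose_neg)
  then show ?thesis by (simp flip: table_bracket_anticomm)
qed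

lemma table_bracket_single:
  "table_bracket T (Poly_Mapping.single a r) (Poly_Mapping.single b s) = pscale (r * s) (T a b - T b a)"
  by (subst table_bracket_superset[of "{a}" "{b}"]) auto

lemma linear_eq_0_on_basis:
  assumes "Vector_Spaces.linear pscale pscale (f :: ('b \<Rightarrow>\<^sub>0 complex) \<Rightarrow> ('c \<Rightarrow>\<^sub>0 complex))"
    and "\<And>b. f (Poly_Mapping.single b 1) = 0"
  shows "f p = 0"
proof -
  interpret f: Vector_Spaces.linear pscale pscale f by (rule assms)
  have "p = (\<Sum>b\<in>Poly_Mapping.keys p. pscale (Poly_Mapping.lookup p b) (Poly_Mapping.single b 1))"
    by (rule poly_mapping_eqI)
      (auto simp: lookup_sum lookup_single when_def in_keys_iff sum.delta)
  then have "f p = f (\<Sum>b\<in>Poly_Mapping.keys p. pscale (Poly_Mapping.lookup p b) (Poly_Mapping.single b 1))"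
    by simp
  also have "\<dots> = 0" unfolding f.sum f.scale assms(2) by simp
  finally show ?thesis .
qed

lemma lie_algebra_table_bracket:
  assumes J: "\<And>a b c. table_bracket T (Poly_Mapping.single a 1) (T b c - T c b)
       + table_bracket T (Poly_Mapping.single b 1) (T c a - T a c)
       + table_bracket T (Poly_Mapping.single c 1) (T a b - T b a) = 0"
  shows "lie_algebra pscale (table_bracket T)"
proof -
  let ?b = "table_bracket T"
  let ?J = "\<lambda>f g h. ?b f (?b g h) + ?b g (?b h f) + ?b h (?b f g)"
  note R = linear_table_bracket_right[of T] and L = linear_table_bracket_left[of T]
  note c = pscale_pair.linear_compose_add
  have comp: "Vector_Spaces.linear pscale pscale (\<lambda>x. F (G x))"
    if "Vector_Spaces.linear pscale pscale F" "Vector_Spaces.linear pscale pscale G"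
    for F G :: "('a \<Rightarrow>\<^sub>0 complex) \<Rightarrow> ('a \<Rightarrow>\<^sub>0 complex)"
    using Vector_Spaces.linear_compose[OF that(2,1)] by (simp add: o_def)
  note i = c comp[OF R R] comp[OF R L] comp[OF L R] comp[OF L L] R L
  have J0: "?J (Poly_Mapping.single a 1) (Poly_Mapping.single b 1) (Poly_Mapping.single c 1) = 0" for a b c
    using J[of a b c] by (simp add: table_bracket_single)
  have J1: "?J f (Poly_Mapping.single b 1) (Poly_Mapping.single c 1) = 0" for f b c
    by (rule linear_eq_0_on_basis[where f = "\<lambda>f. ?J f (Poly_Mapping.single b 1) (Poly_Mapping.single c 1)"])
      (intro i, rule J0)
  have J2: "?J f g (Poly_Mapping.single c 1) = 0" for f g c
    by (rule linear_eq_0_on_basis[where f = "\<lambda>g. ?J f g (Poly_Mapping.single c 1)"])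
      (intro i, rule J1)
  have J3: "?J f g h = 0" for f g h
    by (rule linear_eq_0_on_basis[where f = "\<lambda>h. ?J f g h"]) (intro i, rule J2)
  have alt: "?b f f = 0" for f
  proof (rule poly_mapping_eqI)
    fix k
    have "Poly_Mapping.lookup (?b f f) k = - Poly_Mapping.lookup (?b f f) k"
      by (subst table_bracket_anticomm) simp
    then show "Poly_Mapping.lookup (?b f f) k = Poly_Mapping.lookup 0 k" by simp
  qed
  show ?thesis
    by (intro lie_algebra.intro lie_algebra_axioms.intro vector_space_pscale R L alt J3)
qed


section \<open>The two algebras\<close>

text \<open>In both index types the constructor \<open>E0 n\<close> resp. \<open>E2 n\<close> stands for the index of
  \<open>e\<^bsub>n+1\<^esub>\<close>, so that the indices correspond exactly to the basis elements.\<close>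

datatype M0_basis = X0 | Y0 | E0 nat

fun M0_table :: "M0_basis \<Rightarrow> M0_basis \<Rightarrow> (M0_basis \<Rightarrow>\<^sub>0 complex)" where
  "M0_table (E0 m) (E0 n) = (if m \<ge> 1 \<and> n = 0 then Poly_Mapping.single (E0 (m + 1)) 1 else 0)"
| "M0_table X0 (E0 n) = (if n = 0 then - Poly_Mapping.single (E0 0) 1
                         else - Poly_Mapping.single (E0 n) (of_nat n))"
| "M0_table Y0 (E0 n) = (if n \<ge> 1 then - Poly_Mapping.single (E0 n) 1 else 0)"
| "M0_table _ _ = 0"

abbreviation M0_bracket :: "(M0_basis \<Rightarrow>\<^sub>0 complex) \<Rightarrow> (M0_basis \<Rightarrow>\<^sub>0 complex) \<Rightarrow> (M0_basis \<Rightarrow>\<^sub>0 complex)"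
  where "M0_bracket \<equiv> table_bracket M0_table"

datatype M2_basis = X2 | E2 nat

fun M2_table :: "M2_basis \<Rightarrow> M2_basis \<Rightarrow> (M2_basis \<Rightarrow>\<^sub>0 complex)" where
  "M2_table (E2 m) (E2 n) = (if m = 0 \<and> n \<ge> 1 then Poly_Mapping.single (E2 (n + 1)) 1
                             else if m = 1 \<and> n \<ge> 2 then Poly_Mapping.single (E2 (n + 2)) 1
                             else 0)"
| "M2_table X2 (E2 n) = - Poly_Mapping.single (E2 n) (of_nat (n + 1))"
| "M2_table _ _ = 0"

abbreviation M2_bracket :: "(M2_basis \<Rightarrow>\<^sub>0 complex) \<Rightarrow> (M2_basis \<Rightarrow>\<^sub>0 complex) \<Rightarrow> (M2_basis \<Rightarrow>\<^sub>0 complex)"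
  where "M2_bracket \<equiv> table_bracket M2_table"

lemma table_bracket_linear_simps:
  "table_bracket T f 0 = 0" "table_bracket T f (- g) = - table_bracket T f g"
  "table_bracket T f (g - h) = table_bracket T f g - table_bracket T f h"
  by (simp_all add: linear_table_bracket_right pscale_pair.linear_0 pscale_pair.linear_neg pscale_pair.linear_diff)

text \<open>The defining brackets in the usual one-based numbering:\<close>

abbreviation e0 :: "nat \<Rightarrow> (M0_basis \<Rightarrow>\<^sub>0 complex)" where
  "e0 i \<equiv> Poly_Mapping.single (E0 (i - 1)) 1"

abbreviation e2 :: "nat \<Rightarrow> (M2_basis \<Rightarrow>\<^sub>0 complex)" where
  "e2 i \<equiv> Poly_Mapping.single (E2 (i - 1)) 1"

lemma M0_brackets:
  "i \<ge> 2 \<Longrightarrow> M0_bracket (e0 i) (e0 1) = e0 (i + 1)"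
  "i \<ge> 2 \<Longrightarrow> j \<ge> 2 \<Longrightarrow> M0_bracket (e0 i) (e0 j) = 0"
  "M0_bracket (Poly_Mapping.single X0 1) (e0 1) = - e0 1"
  "i \<ge> 2 \<Longrightarrow> M0_bracket (Poly_Mapping.single X0 1) (e0 i) = pscale (- of_nat (i - 1)) (e0 i)"
  "M0_bracket (Poly_Mapping.single Y0 1) (e0 1) = 0"
  "i \<ge> 2 \<Longrightarrow> M0_bracket (Poly_Mapping.single Y0 1) (e0 i) = - e0 i"
  "M0_bracket (Poly_Mapping.single X0 1) (Poly_Mapping.single Y0 1) = 0"
  by (auto simp: table_bracket_single of_nat_diff simp flip: single_uminus)

lemma M2_brackets:
  "i \<ge> 2 \<Longrightarrow> M2_bracket (e2 1) (e2 i) = e2 (i + 1)"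
  "j \<ge> 3 \<Longrightarrow> M2_bracket (e2 2) (e2 j) = e2 (j + 2)"
  "i \<ge> 3 \<Longrightarrow> j \<ge> 3 \<Longrightarrow> M2_bracket (e2 i) (e2 j) = 0"
  "M2_bracket (Poly_Mapping.single X2 1) (e2 1) = - e2 1"
  "i \<ge> 2 \<Longrightarrow> M2_bracket (Poly_Mapping.single X2 1) (e2 i) = pscale (- of_nat i) (e2 i)"
  by (auto simp: table_bracket_single single_uminus)

interpretation M0: lie_algebra pscale M0_bracket
proof (rule lie_algebra_table_bracket)
  fix a b c
  show "M0_bracket (Poly_Mapping.single a 1) (M0_table b c - M0_table c b)
      + M0_bracket (Poly_Mapping.single b 1) (M0_table c a - M0_table a c)
      + M0_bracket (Poly_Mapping.single c 1) (M0_table a b - M0_table b a) = 0"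
    by (cases a; cases b; cases c)
      (auto simp: table_bracket_linear_simps table_bracket_single single_uminus [symmetric]
         single_add [symmetric] single_diff [symmetric] algebra_simps)
qed

interpretation M2: lie_algebra pscale M2_bracket
proof (rule lie_algebra_table_bracket)
  fix a b c
  show "M2_bracket (Poly_Mapping.single a 1) (M2_table b c - M2_table c b)
      + M2_bracket (Poly_Mapping.single b 1) (M2_table c a - M2_table a c)
      + M2_bracket (Poly_Mapping.single c 1) (M2_table a b - M2_table b a) = 0"
    by (cases a; cases b; cases c)
      (auto simp: table_bracket_linear_simps table_bracket_single single_uminus [symmetric]
         single_add [symmetric] single_diff [symmetric] algebra_simps)
qed

end

theory Submission
  imports Defs
begin

text \<open>
  Both halves rest on a grading by eigenvalues of an inner derivation.

  For the algebra with indices \<^typ>\<open>M0_basis\<close>, the element \<open>h = x + \<i> y\<close> acts diagonally on the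
  basis. The classical argument that a diagonalisable element acts trivially on cohomology makes
  every cocycle cohomologous to one that preserves the eigenvalues of \<open>ad h\<close>
  (\<open>homogeneous_representative\<close>). Some care is needed because a cochain on an
  infinite-dimensional algebra is only a formal infinite sum of homogeneous components; but the
  cochain \<open>d\<close> with coefficients \<open>\<phi>(h, b)\<^sub>k / (w\<^sub>k - w\<^sub>b)\<close> whose coboundary removes the components
  of nonzero weight is still finite on each basis vector, as \<open>\<phi>(h, b)\<close> is. The factor \<open>\<i>\<close>
  makes preserving the eigenvalues of \<open>h\<close> equivalent to preserving those of \<open>x\<close> and of \<open>y\<close>.
  A homogeneous cocycle is then given by scalars: \<open>\<phi>(x, e\<^sub>i)\<close> and \<open>\<phi>(y, e\<^sub>i)\<close> are multiples of
  \<open>e\<^sub>i\<close>, \<open>\<phi>(e\<^sub>i, e\<^sub>1)\<close> is a multiple of \<open>e\<^bsub>i+1\<^esub>\<close>, and \<open>\<phi>(e\<^sub>i, e\<^sub>j) = 0\<close> for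
  \<open>i, j \<ge> 2\<close>. The cocycle identity says that \<open>\<phi>(x, y) = 0\<close> and that \<open>\<phi>(x, \<cdot>)\<close> and \<open>\<phi>(y, \<cdot>)\<close>
  are derivations of the span of the \<open>e\<^sub>i\<close>. Such diagonal derivations are determined by two
  scalars, so they come from \<open>x\<close> and \<open>y\<close>, while the scalars of \<open>\<phi>(e\<^sub>i, e\<^sub>1)\<close> are removed by a
  recursively chosen diagonal cochain (\<open>M0_homogeneous_cocycle_in_B2\<close>).

  For the algebra with indices \<^typ>\<open>M2_basis\<close>, the homogeneous cochain with
  \<open>\<phi>(e\<^sub>3, e\<^sub>j) = e\<^bsub>j+3\<^esub>\<close> and \<open>\<phi>(e\<^sub>2, e\<^sub>j) = (4 - j) e\<^bsub>j+2\<^esub>\<close> for \<open>j \<ge> 4\<close>, and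
  zero on the pairs of basis vectors not determined by this, is a cocycle (\<open>M2_cocycle\<close>). It is not
  a coboundary (\<open>M2_cocycle_notin_B2\<close>): \<open>[e\<^sub>3, e\<^sub>4] = 0\<close>, and neither \<open>[p, e\<^sub>4]\<close> nor \<open>[e\<^sub>3, p]\<close> ever
  involves \<open>e\<^sub>7\<close>, so no coboundary takes \<open>(e\<^sub>3, e\<^sub>4)\<close> to \<open>e\<^sub>7\<close>.
\<close>

section \<open>Cocycles and coboundaries of a Lie algebra\<close>

context lie_algebra
begin

definition coboundary :: "('a \<Rightarrow> 'a) \<Rightarrow> 'a \<Rightarrow> 'a \<Rightarrow> 'a" where
  "coboundary d a b = bracket (d a) b + bracket a (d b) - d (bracket a b)"

lemma C2_linear:
  assumes "\<phi> \<in> C2"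
  shows "Vector_Spaces.linear scale scale (\<phi> a)" "Vector_Spaces.linear scale scale (\<lambda>a. \<phi> a b)"
  using assms by (auto simp: C2_def)

lemma C2_linear_simps:
  assumes "\<phi> \<in> C2"
  shows "\<phi> (a + b) c = \<phi> a c + \<phi> b c" "\<phi> c (a + b) = \<phi> c a + \<phi> c b"
    "\<phi> (scale r a) c = scale r (\<phi> a c)" "\<phi> c (scale r a) = scale r (\<phi> c a)"
    "\<phi> (- a) c = - \<phi> a c" "\<phi> c (- a) = - \<phi> c a"
    "\<phi> 0 c = 0" "\<phi> c 0 = 0"
proof -
  interpret l: Vector_Spaces.linear scale scale "\<lambda>a. \<phi> a c" by (rule C2_linear[OF assms])
  interpret r: Vector_Spaces.linear scale scale "\<lambda>a. \<phi> c a" by (rule C2_linear[OF assms])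
  show "\<phi> (a + b) c = \<phi> a c + \<phi> b c" "\<phi> c (a + b) = \<phi> c a + \<phi> c b"
    "\<phi> (scale r a) c = scale r (\<phi> a c)" "\<phi> c (scale r a) = scale r (\<phi> c a)"
    "\<phi> (- a) c = - \<phi> a c" "\<phi> c (- a) = - \<phi> c a"
    "\<phi> 0 c = 0" "\<phi> c 0 = 0"
    using l.add r.add l.neg r.neg l.scale r.scale l.zero r.zero by blast+
qed

lemma C2_self: "\<phi> \<in> C2 \<Longrightarrow> \<phi> a a = 0"
  by (simp add: C2_def)

lemma C2_anticomm:
  assumes "\<phi> \<in> C2"
  shows "\<phi> a b = - \<phi> b a"
proof -
  have "\<phi> (a + b) (a + b) = 0" by (rule C2_self[OF assms])
  then have "\<phi> a b + \<phi> b a = 0"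
    unfolding C2_linear_simps(1,2)[OF assms] by (simp add: C2_self[OF assms] add.commute)
  then show ?thesis by (simp add: eq_neg_iff_add_eq_0)
qed

lemma coboundary_in_B2:
  assumes "Vector_Spaces.linear scale scale d"
  shows "coboundary d \<in> B2"
proof -
  interpret d: Vector_Spaces.linear scale scale d by (rule assms)
  have "coboundary d \<in> C2"
    unfolding C2_def coboundary_def
    by (auto simp: Vector_Spaces.linear_iff vector_space_axioms bracket_linear_simps bracket_self
        d.add d.scale d.zero algebra_simps scale_right_diff_distrib scale_right_distrib
        bracket_anticomm[of _ "d _"])
  then show ?thesis
    unfolding B2_def coboundary_def using assms by blast
qed

lemma C2_diff: "\<phi> \<in> C2 \<Longrightarrow> \<psi> \<in> C2 \<Longrightarrow> \<phi> - \<psi> \<in> C2"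
  by (auto simp: C2_def Vector_Spaces.linear_iff scale_right_diff_distrib)

lemma B2_diff:
  assumes "\<phi> \<in> B2" "\<psi> \<in> B2"
  shows "\<phi> - \<psi> \<in> B2"
proof -
  obtain d where d: "Vector_Spaces.linear scale scale d" "\<phi> = coboundary d"
    using assms(1) by (auto simp: B2_def coboundary_def fun_eq_iff)
  obtain e where e: "Vector_Spaces.linear scale scale e" "\<psi> = coboundary e"
    using assms(2) by (auto simp: B2_def coboundary_def fun_eq_iff)
  have "Vector_Spaces.linear scale scale (\<lambda>a. d a - e a)"
    using d(1) e(1) by (auto simp: Vector_Spaces.linear_iff scale_right_diff_distrib)
  moreover have "\<phi> - \<psi> = coboundary (\<lambda>a. d a - e a)"
    by (auto simp: fun_eq_iff d e coboundary_def bracket_linear_simps)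
  ultimately show ?thesis using coboundary_in_B2 by metis
qed

lemma B2_add:
  assumes "\<phi> \<in> B2" "\<psi> \<in> B2"
  shows "\<phi> + \<psi> \<in> B2"
  using B2_diff[OF assms(1) B2_diff[OF zero_in_B2 assms(2)]] by simp

lemma Z2_diff:
  assumes "\<phi> \<in> Z2" "\<psi> \<in> Z2"
  shows "\<phi> - \<psi> \<in> Z2"
proof -
  define J where "J \<phi> a b c = bracket a (\<phi> b c) - bracket (\<phi> a b) c + bracket (\<phi> a c) b
       + \<phi> a (bracket b c) - \<phi> (bracket a b) c + \<phi> (bracket a c) b" for \<phi> a b c
  have "J (\<phi> - \<psi>) a b c = J \<phi> a b c - J \<psi> a b c" for a b c
    by (simp add: J_def bracket_linear_simps)
  then show ?thesis
    using assms C2_diff unfolding Z2_def J_def[symmetric] by auto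
qed

lemma H2_trivial_iff: "H2 = {B2} \<longleftrightarrow> Z2 \<subseteq> B2"
proof
  assume H: "H2 = {B2}"
  show "Z2 \<subseteq> B2"
  proof
    fix \<phi> assume "\<phi> \<in> Z2"
    then have "\<phi> +o B2 = B2" using H by (auto simp: H2_def)
    moreover have "\<phi> \<in> \<phi> +o B2" using zero_in_B2 by (force simp: elt_set_plus_def)
    ultimately show "\<phi> \<in> B2" by simp
  qed
next
  assume Z: "Z2 \<subseteq> B2"
  have "\<phi> +o B2 = B2" if "\<phi> \<in> Z2" for \<phi>
  proof -
    have "\<phi> \<in> B2" using Z that by blast
    then have "\<psi> \<in> \<phi> +o B2" if "\<psi> \<in> B2" for \<psi>
      using B2_diff[OF that] by (auto simp: elt_set_plus_def intro!: bexI[of _ "\<psi> - \<phi>"])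
    with \<open>\<phi> \<in> B2\<close> show ?thesis by (auto simp: elt_set_plus_def B2_add)
  qed
  moreover have "0 \<in> Z2" using zero_in_B2 B2_subset_Z2 by blast
  ultimately show "H2 = {B2}" unfolding H2_def by (auto simp: image_def)
qed

lemma cocycle_eq:
  assumes "\<phi> \<in> Z2"
  shows "bracket a (\<phi> b c) - bracket (\<phi> a b) c + bracket (\<phi> a c) b
       + \<phi> a (bracket b c) - \<phi> (bracket a b) c + \<phi> (bracket a c) b = 0"
  using assms by (auto simp: Z2_def)

lemma Z2_imp_C2: "\<phi> \<in> Z2 \<Longrightarrow> \<phi> \<in> C2"
  by (simp add: Z2_def)

text \<open>The Cartan formula for a cocycle: the action of \<open>h\<close> on \<open>\<phi>\<close> is the coboundary of the
  contraction of \<open>\<phi>\<close> with \<open>h\<close>. It is the cocycle identity with one argument set to \<open>h\<close>.\<close>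

lemma cartan_formula:
  assumes "\<phi> \<in> Z2"
  shows "bracket h (\<phi> b c) - \<phi> (bracket h b) c - \<phi> b (bracket h c) = coboundary (\<phi> h) b c"
proof -
  have "bracket (\<phi> h c) b = - bracket b (\<phi> h c)" by (rule bracket_anticomm)
  moreover have "\<phi> (bracket h c) b = - \<phi> b (bracket h c)"
    by (rule C2_anticomm[OF Z2_imp_C2[OF assms]])
  ultimately show ?thesis
    using cocycle_eq[OF assms, of h b c]
    unfolding coboundary_def by (simp only: algebra_simps add_uminus_conv_diff add_0_left add_0_right)
qed

lemma bracket_derivation: "bracket h (bracket a b) = bracket (bracket h a) b + bracket a (bracket h b)"
proof -
  have "bracket h (bracket a b) = - (bracket a (bracket b h) + bracket b (bracket h a))"
    using jacobi[of h a b] by (simp only: eq_neg_iff_add_eq_0 add.assoc)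
  also have "\<dots> = bracket (bracket h a) b + bracket a (bracket h b)"
    using bracket_anticomm[of b "bracket h a"] bracket_anticomm[of b h]
    by (simp add: bracket_linear_simps)
  finally show ?thesis .
qed

text \<open>The coboundary operator commutes with the action of \<open>h\<close>; for a 1-cochain on which \<open>h\<close> acts
  as zero, \<open>h\<close> therefore acts as zero on its coboundary.\<close>

lemma coboundary_equivariant:
  assumes "Vector_Spaces.linear scale scale d" "\<And>a. bracket h (d a) = d (bracket h a)"
  shows "bracket h (coboundary d a b) = coboundary d (bracket h a) b + coboundary d a (bracket h b)"
proof -
  interpret d: Vector_Spaces.linear scale scale d by (rule assms)
  show ?thesis
    using bracket_derivation[of h "d a" b] bracket_derivation[of h a "d b"] bracket_derivation[of h a b]
    by (simp add: coboundary_def bracket_linear_simps assms(2) d.add)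
qed

end

section \<open>Linear and bilinear maps in coordinates\<close>

abbreviation basis_vec :: "'b \<Rightarrow> 'b \<Rightarrow>\<^sub>0 complex" where
  "basis_vec b \<equiv> Poly_Mapping.single b 1"

lemma single_eq_0_iff [simp]: "Poly_Mapping.single k v = 0 \<longleftrightarrow> v = 0"
  by (metis lookup_single_eq lookup_zero single_zero)

definition linear_extension :: "('b \<Rightarrow> ('c \<Rightarrow>\<^sub>0 complex)) \<Rightarrow> ('b \<Rightarrow>\<^sub>0 complex) \<Rightarrow> ('c \<Rightarrow>\<^sub>0 complex)" where
  "linear_extension f p = (\<Sum>b\<in>Poly_Mapping.keys p. pscale (Poly_Mapping.lookup p b) (f b))"

lemma linear_extension_superset:
  assumes "finite B" "Poly_Mapping.keys p \<subseteq> B"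
  shows "linear_extension f p = (\<Sum>b\<in>B. pscale (Poly_Mapping.lookup p b) (f b))"
  unfolding linear_extension_def using assms
  by (intro sum.mono_neutral_left) (auto simp: in_keys_iff)

lemma linear_linear_extension: "Vector_Spaces.linear pscale pscale (linear_extension f)"
proof (unfold Vector_Spaces.linear_iff, intro conjI allI vector_space_pscale)
  fix g h :: "'a \<Rightarrow>\<^sub>0 complex"
  let ?B = "Poly_Mapping.keys g \<union> Poly_Mapping.keys h"
  have *: "Poly_Mapping.keys (g + h) \<subseteq> ?B" by (rule keys_add)
  show "linear_extension f (g + h) = linear_extension f g + linear_extension f h"
    by (simp add: * linear_extension_superset[of ?B] lookup_add
        pscale.scale_left_distrib sum.distrib del: keys_add)
next
  fix c :: complex and g :: "'a \<Rightarrow>\<^sub>0 complex"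
  have *: "Poly_Mapping.keys (pscale c g) \<subseteq> Poly_Mapping.keys g" by (auto simp: in_keys_iff)
  show "linear_extension f (pscale c g) = pscale c (linear_extension f g)"
    by (simp add: * linear_extension_superset[of "Poly_Mapping.keys g"] pscale.scale_sum_right)
qed

lemma linear_extension_basis_vec [simp]: "linear_extension f (basis_vec b) = f b"
  by (simp add: linear_extension_def)

lemma linear_extension_0 [simp]: "linear_extension f 0 = 0"
  by (simp add: linear_extension_def)

lemma linear_extension_single: "linear_extension f (Poly_Mapping.single b r) = pscale r (f b)"
  by (simp add: linear_extension_superset[of "{b}"])

lemma linear_eq_on_basis:
  assumes f: "Vector_Spaces.linear pscale pscale (f :: ('b \<Rightarrow>\<^sub>0 complex) \<Rightarrow> ('c \<Rightarrow>\<^sub>0 complex))"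
    and g: "Vector_Spaces.linear pscale pscale g"
    and "\<And>b. f (basis_vec b) = g (basis_vec b)"
  shows "f p = g p"
  using linear_eq_0_on_basis[OF pscale_pair.linear_compose_sub[OF f g], of p] assms(3) by simp

lemma linear_eq_linear_extension:
  assumes "Vector_Spaces.linear pscale pscale (f :: ('b \<Rightarrow>\<^sub>0 complex) \<Rightarrow> ('c \<Rightarrow>\<^sub>0 complex))"
  shows "f p = linear_extension (\<lambda>b. f (basis_vec b)) p"
  by (rule linear_eq_on_basis[OF assms linear_linear_extension]) simp

lemma lookup_linear:
  assumes "Vector_Spaces.linear pscale pscale (f :: ('b \<Rightarrow>\<^sub>0 complex) \<Rightarrow> ('c \<Rightarrow>\<^sub>0 complex))"
  shows "Poly_Mapping.lookup (f p) k
    = (\<Sum>b\<in>Poly_Mapping.keys p. Poly_Mapping.lookup p b * Poly_Mapping.lookup (f (basis_vec b)) k)"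
  by (subst linear_eq_linear_extension[OF assms]) (simp add: linear_extension_def lookup_sum)

lemma bilinear_eq_on_basis:
  assumes "\<And>a. Vector_Spaces.linear pscale pscale (\<lambda>b. \<phi> a b)"
    "\<And>b. Vector_Spaces.linear pscale pscale (\<lambda>a. \<phi> a b)"
    "\<And>a. Vector_Spaces.linear pscale pscale (\<lambda>b. \<psi> a b)"
    "\<And>b. Vector_Spaces.linear pscale pscale (\<lambda>a. \<psi> a b)"
    and "\<And>a b. \<phi> (basis_vec a) (basis_vec b) = \<psi> (basis_vec a) (basis_vec b)"
  shows "\<phi> = \<psi>"
proof (intro ext)
  fix p q
  have "\<phi> p (basis_vec b) = \<psi> p (basis_vec b)" for b
    by (rule linear_eq_on_basis[OF assms(2,4)]) (rule assms(5))
  then show "\<phi> p q = \<psi> p q"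
    by (rule linear_eq_on_basis[OF assms(1,3)])
qed

section \<open>Elements that act diagonally\<close>

locale diagonal_element = lie_algebra pscale bracket
  for bracket :: "('b \<Rightarrow>\<^sub>0 complex) \<Rightarrow> ('b \<Rightarrow>\<^sub>0 complex) \<Rightarrow> ('b \<Rightarrow>\<^sub>0 complex)" +
  fixes h :: "'b \<Rightarrow>\<^sub>0 complex" and w :: "'b \<Rightarrow> complex"
  assumes bracket_h_basis: "bracket h (basis_vec b) = Poly_Mapping.single b (w b)"
begin

lemma bracket_h_basis': "bracket h (basis_vec b) = pscale (w b) (basis_vec b)"
  by (simp add: bracket_h_basis)

lemma lookup_bracket_h: "Poly_Mapping.lookup (bracket h p) k = w k * Poly_Mapping.lookup p k"
  by (simp add: lookup_linear[OF linear_bracket_right] bracket_h_basis lookup_single when_def in_keys_iff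
      if_distrib[of "\<lambda>x. _ * x"] cong: if_cong)

text \<open>If \<open>h\<close> acts on a component of \<open>\<phi>\<close> by a scalar \<open>\<lambda> \<noteq> 0\<close>, the Cartan formula exhibits that
  component as the coboundary of its contraction with \<open>h\<close> divided by \<open>\<lambda>\<close>. This is the sum of these
  contractions over all \<open>\<lambda> \<noteq> 0\<close>; the components with \<open>\<lambda> = 0\<close> drop out because division by zero
  gives zero.\<close>

definition weight_homotopy where
  "weight_homotopy \<phi> = linear_extension (\<lambda>b.
     Poly_Mapping.mapp (\<lambda>k v. v / (w k - w b)) (\<phi> h (basis_vec b)))"

lemma linear_weight_homotopy: "Vector_Spaces.linear pscale pscale (weight_homotopy \<phi>)"
  by (simp add: weight_homotopy_def linear_linear_extension)

lemma lookup_weight_homotopy_basis: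
  "Poly_Mapping.lookup (weight_homotopy \<phi> (basis_vec b)) k
     = Poly_Mapping.lookup (\<phi> h (basis_vec b)) k / (w k - w b)"
  by (simp add: weight_homotopy_def lookup_mapp when_def in_keys_iff)

text \<open>As \<open>h\<close> commutes with itself, only basis vectors of weight zero occur in it. So the
  denominators \<open>w\<^sub>k - w\<^sub>b\<close> reduce to \<open>w\<^sub>k\<close> and the sum collapses to \<open>\<phi>(h, h) = 0\<close>.\<close>

lemma weight_homotopy_h:
  assumes "\<phi> \<in> C2"
  shows "weight_homotopy \<phi> h = 0"
proof (rule poly_mapping_eqI)
  fix k
  have w0: "w b = 0" if "b \<in> Poly_Mapping.keys h" for b
    using lookup_bracket_h[of h b] that by (simp add: bracket_self in_keys_iff)
  have "Poly_Mapping.lookup (weight_homotopy \<phi> h) k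
      = (\<Sum>b\<in>Poly_Mapping.keys h. Poly_Mapping.lookup h b * Poly_Mapping.lookup (\<phi> h (basis_vec b)) k / w k)"
    unfolding lookup_linear[OF linear_weight_homotopy, of \<phi> h k] lookup_weight_homotopy_basis
    by (intro sum.cong) (auto simp: w0)
  also have "\<dots> = Poly_Mapping.lookup (\<phi> h h) k / w k"
    by (subst lookup_linear[OF C2_linear(1)[OF assms]]) (simp add: sum_divide_distrib)
  finally show "Poly_Mapping.lookup (weight_homotopy \<phi> h) k = Poly_Mapping.lookup 0 k"
    by (simp add: C2_self[OF assms])
qed

text \<open>The corrected cocycle \<open>\<psi>\<close> has a contraction \<open>\<psi>(h, \<cdot>)\<close> that preserves weights, hence commutes
  with \<open>ad h\<close>. By the Cartan formula the action of \<open>h\<close> on \<open>\<psi>\<close> is the coboundary of this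
  contraction, and by equivariance a second application of \<open>h\<close> gives zero. So a component of \<open>\<psi>\<close>
  on which \<open>h\<close> acts by \<open>\<lambda>\<close> satisfies \<open>\<lambda>\<^sup>2 \<psi>\<^sub>\<lambda> = 0\<close>.\<close>

lemma homogeneous_representative:
  assumes "\<phi> \<in> Z2"
  defines "\<psi> \<equiv> \<phi> - coboundary (weight_homotopy \<phi>)"
  shows "\<psi> \<in> Z2"
    and "w k \<noteq> w a + w b \<Longrightarrow> Poly_Mapping.lookup (\<psi> (basis_vec a) (basis_vec b)) k = 0"
proof -
  let ?d = "weight_homotopy \<phi>"
  interpret d: Vector_Spaces.linear pscale pscale ?d by (rule linear_weight_homotopy)
  show \<psi>: "\<psi> \<in> Z2"
    unfolding \<psi>_def using assms(1) coboundary_in_B2[OF linear_weight_homotopy] B2_subset_Z2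
    by (intro Z2_diff) auto
  note C = Z2_imp_C2[OF \<psi>]
  \<comment> \<open>Here \<open>d(h) = 0\<close> matters: it removes the term \<open>[d(h), b]\<close> from \<open>\<psi>(h, b)\<close>.\<close>
  have \<psi>h: "w k \<noteq> w b \<Longrightarrow> Poly_Mapping.lookup (\<psi> h (basis_vec b)) k = 0" for b k
  proof -
    assume "w k \<noteq> w b"
    then show ?thesis
      by (simp add: \<psi>_def coboundary_def weight_homotopy_h Z2_imp_C2[OF assms(1)] lookup_minus lookup_add
          bracket_linear_simps lookup_bracket_h bracket_h_basis' d.scale lookup_weight_homotopy_basis diff_divide_distrib[symmetric] left_diff_distrib[symmetric]
          del: pscale_single)
  qed
  have comm: "bracket h (\<psi> h p) = \<psi> h (bracket h p)" for p
  proof (rule linear_eq_on_basis[of "\<lambda>p. bracket h (\<psi> h p)" "\<lambda>p. \<psi> h (bracket h p)"])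
    show "Vector_Spaces.linear pscale pscale (\<lambda>p. bracket h (\<psi> h p))"
      "Vector_Spaces.linear pscale pscale (\<lambda>p. \<psi> h (bracket h p))"
      using Vector_Spaces.linear_compose[OF C2_linear(1)[OF C, of h] linear_bracket_right[of h]]
        Vector_Spaces.linear_compose[OF linear_bracket_right[of h] C2_linear(1)[OF C, of h]]
      by (simp_all add: o_def)
    fix b
    show "bracket h (\<psi> h (basis_vec b)) = \<psi> h (bracket h (basis_vec b))"
      using \<psi>h[of _ b]
      by (intro poly_mapping_eqI) (auto simp: lookup_bracket_h bracket_h_basis' C2_linear_simps[OF C]
          simp del: pscale_single)
  qed
  assume ne: "w k \<noteq> w a + w b"
  let ?v = "\<psi> (basis_vec a) (basis_vec b)"
  let ?u = "coboundary (\<psi> h) (basis_vec a) (basis_vec b)"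
  have u: "?u = bracket h ?v - pscale (w a) ?v - pscale (w b) ?v"
    using cartan_formula[OF \<psi>, of h "basis_vec a" "basis_vec b"]
    by (simp only: bracket_h_basis' C2_linear_simps[OF C])
  have cC: "coboundary (\<psi> h) \<in> C2"
    using coboundary_in_B2[OF C2_linear(1)[OF C]] by (simp add: B2_def)
  have "bracket h ?u = pscale (w a) ?u + pscale (w b) ?u"
    using coboundary_equivariant[OF C2_linear(1)[OF C] comm, of "basis_vec a" "basis_vec b"]
    by (simp only: bracket_h_basis' C2_linear_simps[OF cC])
  then have "Poly_Mapping.lookup (bracket h ?u) k
      = Poly_Mapping.lookup (pscale (w a) ?u + pscale (w b) ?u) k" by simp
  then have "w k * Poly_Mapping.lookup ?u k = (w a + w b) * Poly_Mapping.lookup ?u k"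
    by (simp add: lookup_bracket_h lookup_add algebra_simps)
  then have "Poly_Mapping.lookup ?u k = 0" using ne by auto
  then have "(w k - w a - w b) * Poly_Mapping.lookup ?v k = 0"
    unfolding u by (simp add: lookup_bracket_h lookup_minus lookup_add algebra_simps)
  moreover have "w k - w a - w b \<noteq> 0" using ne by (simp add: diff_diff_eq)
  ultimately show "Poly_Mapping.lookup ?v k = 0" by simp
qed

end

section \<open>Vanishing for the first algebra\<close>

lemma eq_single_if_lookup:
  assumes "\<And>k. k \<noteq> b \<Longrightarrow> Poly_Mapping.lookup p k = 0"
  shows "p = Poly_Mapping.single b (Poly_Mapping.lookup p b)"
  using assms by (intro poly_mapping_eqI) (auto simp: lookup_single when_def)

text \<open>The eigenvalues of \<open>ad (x + \<i> y)\<close>: the real part is the eigenvalue of \<open>x\<close> and the imaginary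
  part that of \<open>y\<close>.\<close>

definition M0_weight :: "M0_basis \<Rightarrow> complex" where
  "M0_weight b = (case b of E0 n \<Rightarrow> if n = 0 then - 1 else - (of_nat n + \<i>) | _ \<Rightarrow> 0)"

interpretation M0: diagonal_element M0_bracket "basis_vec X0 + Poly_Mapping.single Y0 \<i>" M0_weight
proof unfold_locales
  fix b
  show "M0_bracket (basis_vec X0 + Poly_Mapping.single Y0 \<i>) (basis_vec b) = Poly_Mapping.single b (M0_weight b)"
    by (cases b)
      (auto simp: M0.bracket_linear_simps table_bracket_single M0_weight_def single_uminus [symmetric]
         single_add [symmetric] algebra_simps)
qed

text \<open>All weight spaces but that of weight zero are lines, so homogeneity leaves at most one scalar for
  each pair of basis vectors, apart from \<open>\<phi>(x, y)\<close>. The cocycle identity on \<open>(x, y, e\<^sub>n)\<close> forces \<open>\<phi>(x, y)\<close>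
  to commute with every \<open>e\<^sub>n\<close>, hence to vanish. On \<open>(x, e\<^sub>n, e\<^sub>1)\<close> and \<open>(y, e\<^sub>n, e\<^sub>1)\<close> it makes the
  scalars of \<open>\<phi>(x, \<cdot>)\<close> and \<open>\<phi>(y, \<cdot>)\<close> affine in \<open>n \<ge> 2\<close>, which is what lets an element of the span of
  \<open>x\<close> and \<open>y\<close> realise them.\<close>

lemma M0_homogeneous_cocycle_in_B2:
  assumes \<psi>: "\<psi> \<in> M0.Z2"
    and hom: "\<And>a b k. M0_weight k \<noteq> M0_weight a + M0_weight b \<Longrightarrow>
      Poly_Mapping.lookup (\<psi> (basis_vec a) (basis_vec b)) k = 0"
  shows "\<psi> \<in> M0.B2"
proof -
  note C = M0.Z2_imp_C2[OF \<psi>]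
  note lin = M0.C2_linear_simps[OF C]
  define pX where "pX n = Poly_Mapping.lookup (\<psi> (basis_vec X0) (basis_vec (E0 n))) (E0 n)" for n
  define pY where "pY n = Poly_Mapping.lookup (\<psi> (basis_vec Y0) (basis_vec (E0 n))) (E0 n)" for n
  define c where "c n = Poly_Mapping.lookup (\<psi> (basis_vec (E0 n)) (basis_vec (E0 0))) (E0 (Suc n))" for n
  have XE: "\<psi> (basis_vec X0) (basis_vec (E0 n)) = Poly_Mapping.single (E0 n) (pX n)" for n
    unfolding pX_def
    by (intro eq_single_if_lookup hom)
      (auto simp: M0_weight_def complex_eq_iff split: M0_basis.splits if_splits)
  have YE: "\<psi> (basis_vec Y0) (basis_vec (E0 n)) = Poly_Mapping.single (E0 n) (pY n)" for n
    unfolding pY_def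
    by (intro eq_single_if_lookup hom)
      (auto simp: M0_weight_def complex_eq_iff split: M0_basis.splits if_splits)
  have E1: "\<psi> (basis_vec (E0 n)) (basis_vec (E0 0)) = Poly_Mapping.single (E0 (Suc n)) (c n)" if "n \<ge> 1" for n
    unfolding c_def using that
    by (intro eq_single_if_lookup hom)
      (auto simp: M0_weight_def complex_eq_iff split: M0_basis.splits if_splits)
  have EE: "\<psi> (basis_vec (E0 n)) (basis_vec (E0 m)) = 0" if "n \<ge> 1" "m \<ge> 1" for n m
    using that
    by (intro poly_mapping_eqI, subst hom)
      (auto simp: M0_weight_def complex_eq_iff split: M0_basis.splits if_splits)
  have bilin: "\<psi> (Poly_Mapping.single a u) (Poly_Mapping.single b v) = pscale (u * v) r"
    if "\<psi> (basis_vec a) (basis_vec b) = r" for a b u v r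
  proof -
    have "\<psi> (Poly_Mapping.single a u) (Poly_Mapping.single b v) = \<psi> (pscale u (basis_vec a)) (pscale v (basis_vec b))"
      by simp
    also have "\<dots> = pscale (u * v) r"
      by (simp only: lin that pscale.scale_scale mult.commute)
    finally show ?thesis .
  qed
  have EX: "\<psi> (basis_vec (E0 n)) (basis_vec X0) = Poly_Mapping.single (E0 n) (- pX n)" for n
    by (subst M0.C2_anticomm[OF C]) (simp add: XE single_uminus)
  have EY: "\<psi> (basis_vec (E0 n)) (basis_vec Y0) = Poly_Mapping.single (E0 n) (- pY n)" for n
    by (subst M0.C2_anticomm[OF C]) (simp add: YE single_uminus)
  have E1': "\<psi> (basis_vec (E0 0)) (basis_vec (E0 n)) = Poly_Mapping.single (E0 (Suc n)) (- c n)" if "n \<ge> 1" for n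
    by (subst M0.C2_anticomm[OF C]) (simp add: E1[OF that] single_uminus)
  have on_single:
    "\<psi> (Poly_Mapping.single X0 u) (Poly_Mapping.single (E0 n) v) = Poly_Mapping.single (E0 n) (u * v * pX n)"
    "\<psi> (Poly_Mapping.single (E0 n) u) (Poly_Mapping.single X0 v) = Poly_Mapping.single (E0 n) (- (u * v * pX n))"
    "\<psi> (Poly_Mapping.single Y0 u) (Poly_Mapping.single (E0 n) v) = Poly_Mapping.single (E0 n) (u * v * pY n)"
    "\<psi> (Poly_Mapping.single (E0 n) u) (Poly_Mapping.single Y0 v) = Poly_Mapping.single (E0 n) (- (u * v * pY n))"
    "n \<ge> 1 \<Longrightarrow> \<psi> (Poly_Mapping.single (E0 n) u) (Poly_Mapping.single (E0 0) v)
       = Poly_Mapping.single (E0 (Suc n)) (u * v * c n)"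
    "n \<ge> 1 \<Longrightarrow> \<psi> (Poly_Mapping.single (E0 0) u) (Poly_Mapping.single (E0 n) v)
       = Poly_Mapping.single (E0 (Suc n)) (- (u * v * c n))" for n u v
    by (simp_all add: bilin[OF XE] bilin[OF YE] bilin[OF EX] bilin[OF EY] bilin[OF E1] bilin[OF E1'])
  have XY: "\<psi> (basis_vec X0) (basis_vec Y0) = 0"
  proof -
    define r s where "r = Poly_Mapping.lookup (\<psi> (basis_vec X0) (basis_vec Y0)) X0"
      and "s = Poly_Mapping.lookup (\<psi> (basis_vec X0) (basis_vec Y0)) Y0"
    have *: "\<psi> (basis_vec X0) (basis_vec Y0) = Poly_Mapping.single X0 r + Poly_Mapping.single Y0 s"
    proof (rule poly_mapping_eqI)
      fix k
      show "Poly_Mapping.lookup (\<psi> (basis_vec X0) (basis_vec Y0)) k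
          = Poly_Mapping.lookup (Poly_Mapping.single X0 r + Poly_Mapping.single Y0 s) k"
        using hom[of k X0 Y0]
        by (cases k) (auto simp: r_def s_def lookup_add lookup_single M0_weight_def complex_eq_iff)
    qed
    have **: "M0_bracket (\<psi> (basis_vec X0) (basis_vec Y0)) (basis_vec (E0 n)) = 0" for n
      using M0.cocycle_eq[OF \<psi>, of "basis_vec X0" "basis_vec Y0" "basis_vec (E0 n)"]
      by (cases "n = 0") (auto simp: table_bracket_single single_uminus[symmetric] single_add[symmetric]
          on_single lin algebra_simps)
    have "r = 0" using **[of 0]
      by (simp add: * M0.bracket_linear_simps table_bracket_single)
    moreover have "s = 0" using **[of 1] \<open>r = 0\<close>
      by (simp add: * M0.bracket_linear_simps table_bracket_single)
    ultimately show ?thesis by (simp add: *)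
  qed
  have pX_Suc: "pX (Suc n) = pX n + pX 0" if "n \<ge> 1" for n
  proof -
    have "Poly_Mapping.single (E0 (Suc n)) (pX (Suc n) - pX n - pX 0) = 0"
      using M0.cocycle_eq[OF \<psi>, of "basis_vec X0" "basis_vec (E0 n)" "basis_vec (E0 0)"] that
      by (simp add: table_bracket_single single_uminus[symmetric] on_single lin
          flip: single_add single_diff) (simp add: algebra_simps)
    then show ?thesis by (simp add: algebra_simps)
  qed
  have pY_Suc: "pY (Suc n) = pY n + pY 0" if "n \<ge> 1" for n
  proof -
    have "Poly_Mapping.single (E0 (Suc n)) (pY (Suc n) - pY n - pY 0) = 0"
      using M0.cocycle_eq[OF \<psi>, of "basis_vec Y0" "basis_vec (E0 n)" "basis_vec (E0 0)"] that
      by (simp add: table_bracket_single single_uminus[symmetric] on_single lin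
          flip: single_add single_diff) (simp add: algebra_simps)
    then show ?thesis by (simp add: algebra_simps)
  qed
  have pX_eq: "pX n = pX 1 + of_nat (n - 1) * pX 0" if "n \<ge> 1" for n
    using that by (induction n rule: dec_induct) (auto simp: pX_Suc of_nat_diff algebra_simps)
  have pY_eq: "pY n = pY 1 + of_nat (n - 1) * pY 0" if "n \<ge> 1" for n
    using that by (induction n rule: dec_induct) (auto simp: pY_Suc of_nat_diff algebra_simps)
  \<comment> \<open>On \<open>x\<close> and \<open>y\<close>, the element \<open>r x + s y\<close> with \<open>[r x + s y, \<cdot>]\<close> equal to \<open>\<psi>(x, \<cdot>)\<close> resp. \<open>\<psi>(y, \<cdot>)\<close>
      on the span of the \<^term>\<open>basis_vec (E0 n)\<close>: since \<open>r x + s y\<close> acts on \<^term>\<open>basis_vec (E0 0)\<close> by \<open>- r\<close> and on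
      \<^term>\<open>basis_vec (E0 1)\<close> by \<open>- (r + s)\<close>, the values there determine \<open>r\<close> and \<open>s\<close>.
      On the vectors \<^term>\<open>basis_vec (E0 n)\<close>, the solution of \<open>d\<^sub>n - d\<^bsub>n+1\<^esub> = c\<^sub>n\<close> (\<open>n \<ge> 1\<close>) with \<open>d\<^sub>0 = d\<^sub>1 = 0\<close>.\<close>
  define D where "D b = (case b of
      X0 \<Rightarrow> Poly_Mapping.single X0 (- pX 0) + Poly_Mapping.single Y0 (pX 0 - pX 1)
    | Y0 \<Rightarrow> Poly_Mapping.single X0 (- pY 0) + Poly_Mapping.single Y0 (pY 0 - pY 1)
    | E0 n \<Rightarrow> Poly_Mapping.single (E0 n) (- (\<Sum>m = 1..<n. c m)))" for b
  let ?\<delta> = "M0.coboundary (linear_extension D)"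
  have B: "?\<delta> \<in> M0.B2"
    by (intro M0.coboundary_in_B2 linear_linear_extension)
  then have C\<delta>: "?\<delta> \<in> M0.C2" by (simp add: M0.B2_def)
  let ?agree = "\<lambda>a b. \<psi> (basis_vec a) (basis_vec b) = ?\<delta> (basis_vec a) (basis_vec b)"
  have sym: "?agree b a" if "?agree a b" for a b
    using that M0.C2_anticomm[OF C, of "basis_vec b"] M0.C2_anticomm[OF C\<delta>, of "basis_vec b"] by simp
  note calc = M0.coboundary_def D_def M0.bracket_linear_simps table_bracket_single linear_extension_single
  have aXY: "?agree X0 Y0"
    by (simp add: XY calc)
  have aXE: "?agree X0 (E0 n)" for n
    by (cases "n = 0") (auto simp: XE calc pX_eq[of n] single_uminus[symmetric] single_add[symmetric] algebra_simps)
  have aYE: "?agree Y0 (E0 n)" for n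
    by (cases "n = 0") (auto simp: YE calc pY_eq[of n] single_uminus[symmetric] single_add[symmetric] algebra_simps)
  have aE1: "?agree (E0 n) (E0 0)" if "n \<ge> 1" for n
    using that by (simp add: E1 calc single_uminus[symmetric] single_diff[symmetric])
  have aEE: "?agree (E0 n) (E0 m)" if "n \<ge> 1" "m \<ge> 1" for n m
    using that by (simp add: EE calc)
  have refl: "?agree a a" for a
    by (simp add: M0.C2_self[OF C] M0.C2_self[OF C\<delta>])
  have "?agree a b" for a b
  proof (cases a; cases b)
    fix m n assume "a = E0 m" "b = E0 n"
    then show ?thesis
      using aE1[of m] sym[OF aE1[of n]] aEE[of m n] refl[of "E0 0"] by (cases m; cases n) auto
  qed (use aXY aXE aYE sym refl in simp_all)
  then have "\<psi> = ?\<delta>"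
    by (intro bilinear_eq_on_basis M0.C2_linear C C\<delta>)
  with B show ?thesis by simp
qed

lemma M0_Z2_subset_B2: "M0.Z2 \<subseteq> M0.B2"
proof
  fix \<phi> assume \<phi>: "\<phi> \<in> M0.Z2"
  let ?\<delta> = "M0.coboundary (M0.weight_homotopy \<phi>)"
  have "\<phi> - ?\<delta> \<in> M0.B2"
    using M0.homogeneous_representative[OF \<phi>] by (intro M0_homogeneous_cocycle_in_B2) auto
  from M0.B2_add[OF this M0.coboundary_in_B2[OF M0.linear_weight_homotopy[of \<phi>]]]
  show "\<phi> \<in> M0.B2" by simp
qed

section \<open>A nontrivial class for the second algebra\<close>

lemma table_bracket_in_C2:
  fixes br :: "('b \<Rightarrow>\<^sub>0 complex) \<Rightarrow> ('b \<Rightarrow>\<^sub>0 complex) \<Rightarrow> ('b \<Rightarrow>\<^sub>0 complex)"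
    and T :: "'b \<Rightarrow> 'b \<Rightarrow> ('b \<Rightarrow>\<^sub>0 complex)"
  assumes "lie_algebra pscale br"
  shows "table_bracket T \<in> lie_algebra.C2 pscale"
proof -
  interpret lie_algebra pscale br by (rule assms)
  have "table_bracket T f f = 0" for f
  proof (rule poly_mapping_eqI)
    fix k
    have "Poly_Mapping.lookup (table_bracket T f f) k = - Poly_Mapping.lookup (table_bracket T f f) k"
      by (subst table_bracket_anticomm) simp
    then show "Poly_Mapping.lookup (table_bracket T f f) k = Poly_Mapping.lookup 0 k" by simp
  qed
  then show ?thesis
    by (simp add: C2_def linear_table_bracket_left linear_table_bracket_right)
qed

lemma Z2_if_cocycle_on_basis:
  assumes "lie_algebra pscale br" and C: "\<phi> \<in> lie_algebra.C2 pscale"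
    and basis: "\<And>a b c. br (basis_vec a) (\<phi> (basis_vec b) (basis_vec c))
       - br (\<phi> (basis_vec a) (basis_vec b)) (basis_vec c)
       + br (\<phi> (basis_vec a) (basis_vec c)) (basis_vec b)
       + \<phi> (basis_vec a) (br (basis_vec b) (basis_vec c))
       - \<phi> (br (basis_vec a) (basis_vec b)) (basis_vec c)
       + \<phi> (br (basis_vec a) (basis_vec c)) (basis_vec b) = 0"
  shows "\<phi> \<in> lie_algebra.Z2 pscale br"
proof -
  interpret lie_algebra pscale br by (rule assms)
  let ?J = "\<lambda>a b c. br a (\<phi> b c) - br (\<phi> a b) c + br (\<phi> a c) b
       + \<phi> a (br b c) - \<phi> (br a b) c + \<phi> (br a c) b"
  note R = linear_bracket_right linear_bracket_left C2_linear[OF C]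
  have comp: "Vector_Spaces.linear pscale pscale (\<lambda>x. F (G x))"
    if "Vector_Spaces.linear pscale pscale F" "Vector_Spaces.linear pscale pscale G"
    for F G :: "('a \<Rightarrow>\<^sub>0 complex) \<Rightarrow> ('a \<Rightarrow>\<^sub>0 complex)"
    using Vector_Spaces.linear_compose[OF that(2,1)] by (simp add: o_def)
  have comps: "Vector_Spaces.linear pscale pscale (\<lambda>x. br a (G x))"
    "Vector_Spaces.linear pscale pscale (\<lambda>x. br (G x) a)"
    "Vector_Spaces.linear pscale pscale (\<lambda>x. \<phi> a (G x))"
    "Vector_Spaces.linear pscale pscale (\<lambda>x. \<phi> (G x) a)"
    if "Vector_Spaces.linear pscale pscale G" for G :: "('a \<Rightarrow>\<^sub>0 complex) \<Rightarrow> ('a \<Rightarrow>\<^sub>0 complex)" and a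
    using comp[OF _ that] R by blast+
  note i = pscale_pair.linear_compose_add pscale_pair.linear_compose_sub comps R
  have J1: "?J f (basis_vec b) (basis_vec c) = 0" for f b c
    by (rule linear_eq_0_on_basis[where f = "\<lambda>f. ?J f (basis_vec b) (basis_vec c)"])
      (intro i, rule basis)
  have J2: "?J f g (basis_vec c) = 0" for f g c
    by (rule linear_eq_0_on_basis[where f = "\<lambda>g. ?J f g (basis_vec c)"]) (intro i, rule J1)
  have "?J f g h = 0" for f g h
    by (rule linear_eq_0_on_basis[where f = "\<lambda>h. ?J f g h"]) (intro i, rule J2)
  with C show ?thesis unfolding Z2_def by blast
qed

text \<open>Up to coboundaries a homogeneous cochain has the form \<open>\<phi>(e\<^sub>i, e\<^sub>j) = c\<^sub>i\<^sub>j e\<^bsub>i+j\<^esub>\<close> with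
  \<open>c\<^sub>1\<^sub>j = 0\<close> and \<open>c\<^sub>2\<^sub>3 = 0\<close>. The cocycle identities on \<open>(e\<^sub>1, e\<^sub>i, e\<^sub>j)\<close> and \<open>(e\<^sub>2, e\<^sub>i, e\<^sub>j)\<close> then give
  \<open>c = S c + T c\<close> for \<open>i, j \<ge> 2\<close> and \<open>c = S\<^sup>2 c + T\<^sup>2 c\<close> for \<open>i, j \<ge> 3\<close>, where \<open>S\<close> and \<open>T\<close> shift the first and
  the second index. Together they give \<open>S T c = 0\<close> on \<open>i, j \<ge> 3\<close>: only the rows of index 2 and 3
  survive, the latter constant and the former an arithmetic progression. The table is this solution,
  with all indices lowered by one.\<close>

fun M2_cocycle_table :: "M2_basis \<Rightarrow> M2_basis \<Rightarrow> (M2_basis \<Rightarrow>\<^sub>0 complex)" where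
  "M2_cocycle_table (E2 m) (E2 n) =
     (if m = 2 \<and> n \<ge> 3 then Poly_Mapping.single (E2 (n + 3)) 1
      else if m = 1 \<and> n \<ge> 3 then Poly_Mapping.single (E2 (n + 2)) (3 - of_nat n)
      else 0)"
| "M2_cocycle_table _ _ = 0"

lemma M2_cocycle: "table_bracket M2_cocycle_table \<in> M2.Z2"
proof (rule Z2_if_cocycle_on_basis[OF M2.lie_algebra_axioms table_bracket_in_C2[OF M2.lie_algebra_axioms]])
  let ?\<phi> = "table_bracket M2_cocycle_table"
  \<comment> \<open>Both maps send the pair \<open>(i, j)\<close> to a multiple of the basis vector of index \<open>i + j + 1\<close>, so
      the identity on the \<open>e\<^sub>n\<close> is one between the scalars \<open>\<beta>\<close> and \<open>\<gamma>\<close>. With \<open>x\<close> among the arguments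
      it expresses that \<open>\<phi>\<close> is homogeneous.\<close>
  define \<beta> :: "nat \<Rightarrow> nat \<Rightarrow> complex" where
    "\<beta> i j = (if i = 0 \<and> j \<ge> 1 \<or> i = 1 \<and> j \<ge> 2 then 1
      else if j = 0 \<and> i \<ge> 1 \<or> j = 1 \<and> i \<ge> 2 then - 1 else 0)" for i j
  define \<gamma> :: "nat \<Rightarrow> nat \<Rightarrow> complex" where
    "\<gamma> i j = (if i = 2 \<and> j \<ge> 3 then 1 else if i = 1 \<and> j \<ge> 3 then 3 - of_nat j
      else if j = 2 \<and> i \<ge> 3 then - 1 else if j = 1 \<and> i \<ge> 3 then of_nat i - 3 else 0)" for i j
  have br: "M2_bracket (Poly_Mapping.single (E2 i) u) (Poly_Mapping.single (E2 j) v)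
      = Poly_Mapping.single (E2 (Suc (i + j))) (u * v * \<beta> i j)" for i j u v
    by (auto simp: table_bracket_single \<beta>_def single_uminus[symmetric] eval_nat_numeral)
  have \<phi>: "?\<phi> (Poly_Mapping.single (E2 i) u) (Poly_Mapping.single (E2 j) v)
      = Poly_Mapping.single (E2 (Suc (i + j))) (u * v * \<gamma> i j)" for i j u v
    by (auto simp: table_bracket_single \<gamma>_def single_uminus[symmetric] single_add[symmetric]
        eval_nat_numeral algebra_simps)
  have brX: "M2_bracket (Poly_Mapping.single X2 u) (Poly_Mapping.single (E2 j) v)
       = Poly_Mapping.single (E2 j) (- (u * v * of_nat (Suc j)))"
    "M2_bracket (Poly_Mapping.single (E2 j) v) (Poly_Mapping.single X2 u)
       = Poly_Mapping.single (E2 j) (u * v * of_nat (Suc j))"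
    "M2_bracket (Poly_Mapping.single X2 u) (Poly_Mapping.single X2 v) = 0" for j u v
    by (simp_all add: table_bracket_single single_uminus[symmetric] algebra_simps)
  have \<phi>X: "?\<phi> (Poly_Mapping.single X2 u) (Poly_Mapping.single b v) = 0"
    "?\<phi> (Poly_Mapping.single b u) (Poly_Mapping.single X2 v) = 0" for b u v
    by (cases b; simp add: table_bracket_single)+
  \<comment> \<open>The scalars depend only on whether an index is 0, 1, 2 or larger, up to terms linear in it.\<close>
  have scalar: "\<gamma> j k * \<beta> i (Suc (j + k)) - \<gamma> i j * \<beta> (Suc (i + j)) k + \<gamma> i k * \<beta> (Suc (i + k)) j
      + \<beta> j k * \<gamma> i (Suc (j + k)) - \<beta> i j * \<gamma> (Suc (i + j)) k + \<beta> i k * \<gamma> (Suc (i + k)) j = 0" for i j k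
  proof -
    have "n = 0 \<or> n = 1 \<or> n = 2 \<or> (\<exists>m. n = Suc (Suc (Suc m)))" for n :: nat
      by presburger
    from this[of i] this[of j] this[of k] show ?thesis
      by (elim disjE exE) (simp_all add: \<beta>_def \<gamma>_def eval_nat_numeral)
  qed
  note C = table_bracket_in_C2[OF M2.lie_algebra_axioms, of M2_cocycle_table]
  fix a b c
  show "M2_bracket (basis_vec a) (?\<phi> (basis_vec b) (basis_vec c))
       - M2_bracket (?\<phi> (basis_vec a) (basis_vec b)) (basis_vec c)
       + M2_bracket (?\<phi> (basis_vec a) (basis_vec c)) (basis_vec b)
       + ?\<phi> (basis_vec a) (M2_bracket (basis_vec b) (basis_vec c))
       - ?\<phi> (M2_bracket (basis_vec a) (basis_vec b)) (basis_vec c)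
       + ?\<phi> (M2_bracket (basis_vec a) (basis_vec c)) (basis_vec b) = 0"
  proof (cases a; cases b; cases c)
    fix i j k assume "a = E2 i" "b = E2 j" "c = E2 k"
    then show ?thesis using scalar[of j k i]
      by (simp add: br \<phi> ac_simps flip: single_add single_diff)
  next
    fix j k assume "a = X2" "b = E2 j" "c = E2 k"
    moreover have "\<gamma> k j = - \<gamma> j k" by (simp add: \<gamma>_def)
    ultimately show ?thesis
      by (simp add: br brX \<phi> \<phi>X M2.bracket_linear_simps algebra_simps flip: single_add single_diff)
  qed (simp_all add: br brX \<phi> \<phi>X M2.bracket_linear_simps M2.C2_linear_simps[OF C]
      flip: single_add single_diff single_uminus, simp_all add: algebra_simps)
qed

lemma M2_cocycle_notin_B2: "table_bracket M2_cocycle_table \<notin> M2.B2"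
proof
  let ?\<phi> = "table_bracket M2_cocycle_table"
  assume "?\<phi> \<in> M2.B2"
  then obtain d where d: "Vector_Spaces.linear pscale pscale d"
    and \<phi>: "?\<phi> a b = M2_bracket (d a) b + M2_bracket a (d b) - d (M2_bracket a b)" for a b
    unfolding M2.B2_def by auto
  \<comment> \<open>A vector \<open>p\<close> could contribute to the coefficient of \<open>e\<^sub>7\<close> in \<open>[p, e\<^sub>4]\<close> only through \<open>e\<^sub>3\<close>, and in
      \<open>[e\<^sub>3, p]\<close> only through \<open>e\<^sub>4\<close>; but \<open>[e\<^sub>3, e\<^sub>4] = 0\<close>.\<close>
  have 1: "Poly_Mapping.lookup (M2_bracket p (basis_vec (E2 3))) (E2 6) = 0" for p
  proof (subst lookup_linear[OF linear_table_bracket_left], intro sum.neutral ballI)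
    fix b
    show "Poly_Mapping.lookup p b * Poly_Mapping.lookup (M2_bracket (basis_vec b) (basis_vec (E2 3))) (E2 6) = 0"
      by (cases b) (auto simp: table_bracket_single lookup_single lookup_minus)
  qed
  have 2: "Poly_Mapping.lookup (M2_bracket (basis_vec (E2 2)) p) (E2 6) = 0" for p
  proof (subst lookup_linear[OF linear_table_bracket_right], intro sum.neutral ballI)
    fix b
    show "Poly_Mapping.lookup p b * Poly_Mapping.lookup (M2_bracket (basis_vec (E2 2)) (basis_vec b)) (E2 6) = 0"
      by (cases b) (auto simp: table_bracket_single lookup_single lookup_minus)
  qed
  have 3: "M2_bracket (basis_vec (E2 2)) (basis_vec (E2 3)) = 0"
    by (simp add: table_bracket_single)
  have "Poly_Mapping.lookup (?\<phi> (basis_vec (E2 2)) (basis_vec (E2 3))) (E2 6) = 0"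
    unfolding \<phi> 3 by (simp add: lookup_add lookup_minus 1 2 pscale_pair.linear_0[OF d])
  moreover have "Poly_Mapping.lookup (?\<phi> (basis_vec (E2 2)) (basis_vec (E2 3))) (E2 6) = 1"
    by (simp add: table_bracket_single)
  ultimately show False by simp
qed

theorem theorem3p10:
  shows "M0.H2 = {M0.B2} \<and> M2.H2 \<noteq> {M2.B2}"
  unfolding M0.H2_trivial_iff M2.H2_trivial_iff
  using M0_Z2_subset_B2 M2_cocycle M2_cocycle_notin_B2 by blast

end
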